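(* (i) Let $R$ be a ring and let $e,e'\in R$ be idempotents. If $ee'-e'e$ is a unit of $R$, then $ee'+e'e$ is a unit of $R$. (ii) The converse of this implication fails in general: there exist a ring $R$ and idempotents $e,e'\in R$ such that $ee'+e'e$ is a unit of $R$ but $ee'-e'e$ is not. (iii) In particular of (i), if a ring $R$ has Property K, then it has Property $\overline{\mathrm K}$.
   Context: Rings are associative with identity, not necessarily commutative. A ring $R$ has Property K if there exist idempotents $e,e'\in R$ such that the commutator $ee'-e'e$ is a unit of $R$. A ring $R$ has Property $\overline{\mathrm K}$ if there exist idempotents $e,e'\in R$ such that the anti-commutator $ee'+e'e$ is a unit of $R$. *)

theory Defs
  imports "HOL-Algebra.Ring"
begin

definition idempotents :: "('a, 'm) ring_scheme \<Rightarrow> 'a set"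
  where "idempotents R = {e \<in> carrier R. e \<otimes>\<^bsub>R\<^esub> e = e}"

definition commutator :: "('a, 'm) ring_scheme \<Rightarrow> 'a \<Rightarrow> 'a \<Rightarrow> 'a"
  where "commutator R x y = x \<otimes>\<^bsub>R\<^esub> y \<ominus>\<^bsub>R\<^esub> y \<otimes>\<^bsub>R\<^esub> x"

definition anticommutator :: "('a, 'm) ring_scheme \<Rightarrow> 'a \<Rightarrow> 'a \<Rightarrow> 'a"
  where "anticommutator R x y = x \<otimes>\<^bsub>R\<^esub> y \<oplus>\<^bsub>R\<^esub> y \<otimes>\<^bsub>R\<^esub> x"

definition property_K :: "('a, 'm) ring_scheme \<Rightarrow> bool"
  where "property_K R \<longleftrightarrow>
    (\<exists>e \<in> idempotents R. \<exists>e' \<in> idempotents R. commutator R e e' \<in> Units R)"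

definition property_K_bar :: "('a, 'm) ring_scheme \<Rightarrow> bool"
  where "property_K_bar R \<longleftrightarrow>
    (\<exists>e \<in> idempotents R. \<exists>e' \<in> idempotents R. anticommutator R e e' \<in> Units R)"

end

theory Submission
  imports Defs "HOL-Number_Theory.Residues"
begin

text \<open>
  Put \<open>d = e - e'\<close>, \<open>s = e + e'\<close> and \<open>t = s - 1\<close>. Then \<open>ee' - e'e = dt = -td\<close>, so if the
  commutator is a unit, so are \<open>d\<close> and \<open>t\<close>. The identity \<open>sds = d\<^sup>3\<close> shows that \<open>s\<close> is then
  a unit, and \<open>ee' + e'e = st\<close>. For the converse take \<open>e = e' = 1\<close> in a nonzero commutative
  ring in which 2 is invertible, such as the integers modulo 3.
\<close>

text \<open>Without commutativity, a factor of a unit is only one-sidedly invertible. Here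
  \<open>x \<otimes> y\<close> gives a right inverse and \<open>z \<otimes> x\<close> a left
  inverse, and the two must agree.\<close>

lemma (in monoid) Units_if_left_right_factor:
  assumes [simp]: "x \<in> carrier G" "y \<in> carrier G" "z \<in> carrier G"
    and xy: "x \<otimes> y \<in> Units G" and zx: "z \<otimes> x \<in> Units G"
  shows "x \<in> Units G"
proof -
  define r where "r = y \<otimes> inv (x \<otimes> y)"
  define l where "l = inv (z \<otimes> x) \<otimes> z"
  have [simp]: "r \<in> carrier G" "l \<in> carrier G"
    using xy zx by (simp_all add: r_def l_def)
  have r: "x \<otimes> r = \<one>"
    using Units_r_inv[OF xy] xy by (simp add: r_def flip: m_assoc)
  have l: "l \<otimes> x = \<one>"
    using Units_l_inv[OF zx] zx by (simp add: l_def m_assoc)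
  have "l = r"
    using inv_unique[OF l r] by simp
  with l r show ?thesis
    unfolding Units_def by auto
qed

context ring
begin

text \<open>Lets the simplifier use idempotence inside right-associated words, where
  \<open>e \<otimes> e\<close> is no longer a subterm.\<close>

lemma idempotent_mult_left:
  "\<lbrakk>e \<in> carrier R; e \<otimes> e = e; x \<in> carrier R\<rbrakk> \<Longrightarrow> e \<otimes> (e \<otimes> x) = e \<otimes> x"
  by (simp flip: m_assoc)

text \<open>The signed variants make both difference and shifted sum occur as left and as right
  factors of the commutator. With \<open>s\<close>, \<open>d\<close> the sum and difference,
  \<open>sd + ds = 2d\<close> and \<open>ss + dd = 2s\<close>, whence
  \<open>sds = d(2s - ss) = ddd\<close>.\<close>

lemma
  assumes carr [simp]: "e \<in> carrier R" "f \<in> carrier R"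
    and idem [simp]: "e \<otimes> e = e" "f \<otimes> f = f"
  shows commutator_eq_diff_times_sum: "(e \<ominus> f) \<otimes> (e \<oplus> f \<ominus> \<one>) = commutator R e f"
    and sum_times_neg_diff_eq_commutator: "(e \<oplus> f \<ominus> \<one>) \<otimes> (\<ominus> (e \<ominus> f)) = commutator R e f"
    and neg_sum_times_diff_eq_commutator: "(\<ominus> (e \<oplus> f \<ominus> \<one>)) \<otimes> (e \<ominus> f) = commutator R e f"
    and sum_times_pred_eq_anticommutator: "(e \<oplus> f) \<otimes> (e \<oplus> f \<ominus> \<one>) = anticommutator R e f"
    and sum_diff_sum_eq_diff_cubed:
      "(e \<oplus> f) \<otimes> (e \<ominus> f) \<otimes> (e \<oplus> f) = (e \<ominus> f) \<otimes> (e \<ominus> f) \<otimes> (e \<ominus> f)"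
proof -
  \<comment> \<open>Expands into signed words in \<open>e\<close> and \<open>f\<close>, reorders the
    sums and cancels opposite terms.\<close>
  note expand = commutator_def anticommutator_def minus_eq l_distr r_distr l_minus r_minus
    minus_add m_assoc idempotent_mult_left a_ac r_neg r_neg1 r_neg2 l_neg
  show "(e \<ominus> f) \<otimes> (e \<oplus> f \<ominus> \<one>) = commutator R e f"
    by (simp add: expand)
  show "(e \<oplus> f \<ominus> \<one>) \<otimes> (\<ominus> (e \<ominus> f)) = commutator R e f"
    by (simp add: expand)
  show "(\<ominus> (e \<oplus> f \<ominus> \<one>)) \<otimes> (e \<ominus> f) = commutator R e f"
    by (simp add: expand)
  show "(e \<oplus> f) \<otimes> (e \<oplus> f \<ominus> \<one>) = anticommutator R e f"
    by (simp add: expand)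
  show "(e \<oplus> f) \<otimes> (e \<ominus> f) \<otimes> (e \<oplus> f) = (e \<ominus> f) \<otimes> (e \<ominus> f) \<otimes> (e \<ominus> f)"
    by (simp add: expand)
qed

lemma anticommutator_unit_if_commutator_unit:
  assumes "e \<in> idempotents R" "f \<in> idempotents R" and unit: "commutator R e f \<in> Units R"
  shows "anticommutator R e f \<in> Units R"
proof -
  have ef: "e \<in> carrier R" "f \<in> carrier R" "e \<otimes> e = e" "f \<otimes> f = f"
    using assms by (auto simp: idempotents_def)
  define d where "d = e \<ominus> f"
  define s where "s = e \<oplus> f"
  define t where "t = s \<ominus> \<one>"
  have carr: "d \<in> carrier R" "s \<in> carrier R" "t \<in> carrier R"
    using ef by (simp_all add: d_def s_def t_def)
  have c: "d \<otimes> t \<in> Units R" "t \<otimes> (\<ominus> d) \<in> Units R" "(\<ominus> t) \<otimes> d \<in> Units R"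
    using unit
    by (simp_all only: d_def t_def s_def commutator_eq_diff_times_sum[OF ef]
        sum_times_neg_diff_eq_commutator[OF ef] neg_sum_times_diff_eq_commutator[OF ef])
  have d: "d \<in> Units R"
    using Units_if_left_right_factor[of d t "\<ominus> t"] c carr by simp
  have t: "t \<in> Units R"
    using Units_if_left_right_factor[of t "\<ominus> d" d] c carr by simp
  \<comment> \<open>This product is the cube of the unit \<open>d\<close>; bracketing it as
    \<open>s(ds)\<close> and as \<open>(sd)s\<close> puts \<open>s\<close> on either side.\<close>
  have "s \<otimes> d \<otimes> s \<in> Units R"
    using d sum_diff_sum_eq_diff_cubed[OF ef] by (simp add: d_def s_def)
  then have "s \<in> Units R"
    using Units_if_left_right_factor[of s "d \<otimes> s" "s \<otimes> d"] carr by (simp add: m_assoc)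
  with t have "s \<otimes> t \<in> Units R"
    by simp
  then show ?thesis
    using sum_times_pred_eq_anticommutator[OF ef] by (simp add: s_def t_def)
qed

end

lemma residue_ring_3_counterexample:
  defines "R \<equiv> residue_ring 3"
  shows "ring R" "1 \<in> idempotents R" "anticommutator R 1 1 \<in> Units R"
    "commutator R 1 1 \<notin> Units R"
proof -
  interpret residues 3 R
    by unfold_locales (simp_all add: R_def)
  show "ring R"
    by (rule ring_axioms)
  show "1 \<in> idempotents R"
    by (simp add: idempotents_def R_def residue_ring_def)
  have "anticommutator R 1 1 = 2"
    by (simp add: anticommutator_def R_def residue_ring_def)
  \<comment> \<open>Units are the residues coprime to 3, and \<open>3 = 2 + 1\<close>.\<close>
  moreover have "2 \<in> Units R"
    using coprime_add_one_right[of "2 :: int"] by (simp add: res_units_eq)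
  ultimately show "anticommutator R 1 1 \<in> Units R"
    by simp
  have "1 \<in> carrier R"
    by (simp add: R_def residue_ring_def)
  then have "commutator R 1 1 = \<zero>\<^bsub>R\<^esub>"
    by (simp add: commutator_def r_neg minus_eq)
  \<comment> \<open>The description of the units in \<open>res_units_eq\<close> admits only positive
    residues, which excludes 0.\<close>
  then show "commutator R 1 1 \<notin> Units R"
    by (simp add: res_units_eq res_zero_eq)
qed

theorem theoremA:
  shows
    "(\<forall>(R :: ('a, 'm) ring_scheme) e e'.
        ring R \<longrightarrow> e \<in> idempotents R \<longrightarrow> e' \<in> idempotents R \<longrightarrow>
        commutator R e e' \<in> Units R \<longrightarrow> anticommutator R e e' \<in> Units R) \<and>
     (\<exists>(R :: int ring) e e'.
        ring R \<and> e \<in> idempotents R \<and> e' \<in> idempotents R \<and>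
        anticommutator R e e' \<in> Units R \<and> commutator R e e' \<notin> Units R) \<and>
     (\<forall>R :: ('a, 'm) ring_scheme.
        ring R \<longrightarrow> property_K R \<longrightarrow> property_K_bar R)"
proof (intro conjI)
  show "\<exists>(R :: int ring) e e'.
        ring R \<and> e \<in> idempotents R \<and> e' \<in> idempotents R \<and>
        anticommutator R e e' \<in> Units R \<and> commutator R e e' \<notin> Units R"
    using residue_ring_3_counterexample by blast
qed (auto simp: property_K_def property_K_bar_def
    intro: ring.anticommutator_unit_if_commutator_unit)

end
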